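(* Let $n$ be an integer and $t$ a $\lambda C$-term. If $\vdash_{M2}t:N[s^n(0)]$, then $t\simeq_\beta\underline{n}$.
   Context: $\lambda C$-terms are terms of the pure $\lambda$-calculus extended with a constant $C$; $\simeq_\beta$ is $\beta$-equivalence; $\underline{n}=\lambda x\lambda f(f)^nx$ is the Church integer. Types: second-order formulas over a language with constant $0$ and unary function $s$, built from $\perp$ and atomic formulas using $\rightarrow,\forall x,\forall X$; $\neg A=A\rightarrow\perp$; equations $u=v:=\forall Y(Y(u)\rightarrow Y(v))$; a fixed set of equations $E$, $a\approx b$ meaning $E$ entails $a=b$, assumed adequate: $s(a)\not\approx0$ and $s(a)\approx s(b)$ implies $a\approx b$. $M2$: besides ordinary predicate variables there are classical predicate variables $X_C$; a type ends with $X$ if it is $X(\vec t)$, or $A\rightarrow B$ with $B$ ending with $X$, or $\forall vA$ with $A$ ending with $X$; a classical type ends with $\perp$ or a classical variable. Rules: axiom; $\rightarrow$-intro/elim; $\forall x$-intro/elim; $\forall X$-intro/elim (any formula) for ordinary $X$; equational rule (from $t:A[u/x]$, $u\approx v$ get $t:A[v/x]$); $\Gamma\vdash C:\forall X_C\{\neg\neg X_C\rightarrow X_C\}$; $\forall X_C$-intro ($X_C$ not free in context); $\forall X_C$-elim only with classical types. $N[x]=\forall X\{X(0),\forall y(X(y)\rightarrow X(sy))\rightarrow X(x)\}$ with $X$ an ordinary variable. *)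

(* The mixed second-order type system M2 for the lambda-calculus with a constant C.
   All binders (lambda, first-order and second-order quantifiers) are encoded with
   de Bruijn indices. *)
theory Defs
  imports Main
begin

section \<open>Terms of the \<open>\<lambda>C\<close>-calculus\<close>

datatype lam = Var nat | App lam lam | Lam lam | CConst

primrec lift :: "nat \<Rightarrow> lam \<Rightarrow> lam" where
  "lift c (Var i) = Var (if i < c then i else Suc i)"
| "lift c (App t u) = App (lift c t) (lift c u)"
| "lift c (Lam t) = Lam (lift (Suc c) t)"
| "lift c CConst = CConst"

primrec lsubst :: "nat \<Rightarrow> lam \<Rightarrow> lam \<Rightarrow> lam" where
  "lsubst c u (Var i) = (if i < c then Var i else if i = c then u else Var (i - 1))"
| "lsubst c u (App s t) = App (lsubst c u s) (lsubst c u t)"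
| "lsubst c u (Lam t) = Lam (lsubst (Suc c) (lift 0 u) t)"
| "lsubst c u CConst = CConst"

text \<open>Only \<open>\<beta>\<close> is a reduction rule; \<open>C\<close> is an inert constant.\<close>

inductive beta :: "lam \<Rightarrow> lam \<Rightarrow> bool" where
  "beta (App (Lam t) u) (lsubst 0 u t)"
| "beta t t' \<Longrightarrow> beta (App t u) (App t' u)"
| "beta u u' \<Longrightarrow> beta (App t u) (App t u')"
| "beta t t' \<Longrightarrow> beta (Lam t) (Lam t')"

abbreviation beta_eq :: "lam \<Rightarrow> lam \<Rightarrow> bool"  (infix "\<simeq>\<^sub>\<beta>" 50) where
  "t \<simeq>\<^sub>\<beta> u \<equiv> equivclp beta t u"

text \<open>\<open>church n\<close> is \<open>\<lambda>x \<lambda>f (f)\<^sup>n x\<close>: the base point is the outer binder.\<close>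

definition church :: "nat \<Rightarrow> lam" where
  "church n = Lam (Lam ((App (Var 0) ^^ n) (Var 1)))"

section \<open>First-order terms and equational consequence\<close>

datatype 'f trm = TVar nat | Fn 'f "'f trm list"

text \<open>A symbol of a language is a name together with its arity. The constant \<open>0\<close> and the
  successor \<open>s\<close> are distinguished symbols.\<close>

record ('f, 'p) language =
  funs :: "('f \<times> nat) set"
  preds :: "('p \<times> nat) set"
  zero_sym :: 'f
  succ_sym :: 'f

definition wf_language :: "('f, 'p) language \<Rightarrow> bool" where
  "wf_language L \<longleftrightarrow> (zero_sym L, 0) \<in> funs L \<and> (succ_sym L, 1) \<in> funs L"

primrec wf_trm :: "('f, 'p) language \<Rightarrow> 'f trm \<Rightarrow> bool" where
  "wf_trm L (TVar i) \<longleftrightarrow> True"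
| "wf_trm L (Fn f ts) \<longleftrightarrow> (f, length ts) \<in> funs L \<and> list_all (wf_trm L) ts"

definition tzero :: "('f, 'p) language \<Rightarrow> 'f trm" where
  "tzero L = Fn (zero_sym L) []"

definition tsucc :: "('f, 'p) language \<Rightarrow> 'f trm \<Rightarrow> 'f trm" where
  "tsucc L a = Fn (succ_sym L) [a]"

primrec subst_t :: "(nat \<Rightarrow> 'f trm) \<Rightarrow> 'f trm \<Rightarrow> 'f trm" where
  "subst_t \<sigma> (TVar i) = \<sigma> i"
| "subst_t \<sigma> (Fn f ts) = Fn f (map (subst_t \<sigma>) ts)"

text \<open>\<open>(u, v) \<in> E\<close> stands for the equation \<open>u = v\<close>, its variables being universally
  quantified. \<open>eq_conseq L E a b\<close> says that \<open>E\<close> entails \<open>a = b\<close>, by equational deduction.\<close>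

inductive eq_conseq ::
  "('f, 'p) language \<Rightarrow> ('f trm \<times> 'f trm) set \<Rightarrow> 'f trm \<Rightarrow> 'f trm \<Rightarrow> bool"
  for L E where
  eq_inst: "(u, v) \<in> E \<Longrightarrow> \<forall>i. wf_trm L (\<sigma> i) \<Longrightarrow> eq_conseq L E (subst_t \<sigma> u) (subst_t \<sigma> v)"
| eq_refl: "wf_trm L a \<Longrightarrow> eq_conseq L E a a"
| eq_sym: "eq_conseq L E a b \<Longrightarrow> eq_conseq L E b a"
| eq_trans: "eq_conseq L E a b \<Longrightarrow> eq_conseq L E b c \<Longrightarrow> eq_conseq L E a c"
| eq_cong: "(f, length as) \<in> funs L \<Longrightarrow> list_all2 (eq_conseq L E) as bs
    \<Longrightarrow> eq_conseq L E (Fn f as) (Fn f bs)"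

definition wf_equations :: "('f, 'p) language \<Rightarrow> ('f trm \<times> 'f trm) set \<Rightarrow> bool" where
  "wf_equations L E \<longleftrightarrow> (\<forall>(u, v) \<in> E. wf_trm L u \<and> wf_trm L v)"

definition adequate :: "('f, 'p) language \<Rightarrow> ('f trm \<times> 'f trm) set \<Rightarrow> bool" where
  "adequate L E \<longleftrightarrow>
     (\<forall>a. wf_trm L a \<longrightarrow> \<not> eq_conseq L E (tsucc L a) (tzero L)) \<and>
     (\<forall>a b. wf_trm L a \<longrightarrow> wf_trm L b \<longrightarrow>
        eq_conseq L E (tsucc L a) (tsucc L b) \<longrightarrow> eq_conseq L E a b)"

section \<open>Types\<close>

datatype kind = Ord | Cls

text \<open>Predicate variables come in sorts, a sort being a kind (ordinary or classical) and an arity,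
  and every sort has de Bruijn indices of its own. The arity of an occurrence is the length of its
  argument list: \<open>PVar k i ts\<close> is the variable with index \<open>i\<close> of sort \<open>(k, length ts)\<close>, and
  \<open>All2 k n\<close> binds the sort \<open>(k, n)\<close> only. \<open>All1\<close> is the first-order quantifier.\<close>

datatype ('f, 'p) form =
    Bot
  | PVar kind nat "'f trm list"
  | PSym 'p "'f trm list"
  | Imp "('f, 'p) form" "('f, 'p) form"  (infixr "\<rightarrow>\<^sub>t" 55)
  | All1 "('f, 'p) form"
  | All2 kind nat "('f, 'p) form"

abbreviation Neg :: "('f, 'p) form \<Rightarrow> ('f, 'p) form" where
  "Neg A \<equiv> A \<rightarrow>\<^sub>t Bot"

primrec wf_form :: "('f, 'p) language \<Rightarrow> ('f, 'p) form \<Rightarrow> bool" where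
  "wf_form L Bot \<longleftrightarrow> True"
| "wf_form L (PVar k i ts) \<longleftrightarrow> list_all (wf_trm L) ts"
| "wf_form L (PSym p ts) \<longleftrightarrow> (p, length ts) \<in> preds L \<and> list_all (wf_trm L) ts"
| "wf_form L (A \<rightarrow>\<^sub>t B) \<longleftrightarrow> wf_form L A \<and> wf_form L B"
| "wf_form L (All1 A) \<longleftrightarrow> wf_form L A"
| "wf_form L (All2 k n A) \<longleftrightarrow> wf_form L A"

text \<open>The atom a type ends with. Its indices are relative to the quantifiers passed on the way;
  a type may end with a variable that one of these quantifiers binds, so that for example
  \<open>\<forall>X\<^sub>C X\<^sub>C\<close> is a classical type.\<close>

primrec ending :: "('f, 'p) form \<Rightarrow> ('f, 'p) form" where
  "ending Bot = Bot"
| "ending (PVar k i ts) = PVar k i ts"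
| "ending (PSym p ts) = PSym p ts"
| "ending (A \<rightarrow>\<^sub>t B) = ending B"
| "ending (All1 A) = ending A"
| "ending (All2 k n A) = ending A"

definition classical_type :: "('f, 'p) form \<Rightarrow> bool" where
  "classical_type A \<longleftrightarrow> ending A = Bot \<or> (\<exists>i ts. ending A = PVar Cls i ts)"

subsection \<open>First-order substitution\<close>

definition up :: "(nat \<Rightarrow> 'f trm) \<Rightarrow> nat \<Rightarrow> 'f trm" where
  "up \<sigma> i = (case i of 0 \<Rightarrow> TVar 0 | Suc j \<Rightarrow> subst_t (\<lambda>m. TVar (Suc m)) (\<sigma> j))"

primrec subst_f :: "(nat \<Rightarrow> 'f trm) \<Rightarrow> ('f, 'p) form \<Rightarrow> ('f, 'p) form" where
  "subst_f \<sigma> Bot = Bot"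
| "subst_f \<sigma> (PVar k i ts) = PVar k i (map (subst_t \<sigma>) ts)"
| "subst_f \<sigma> (PSym p ts) = PSym p (map (subst_t \<sigma>) ts)"
| "subst_f \<sigma> (A \<rightarrow>\<^sub>t B) = (subst_f \<sigma> A \<rightarrow>\<^sub>t subst_f \<sigma> B)"
| "subst_f \<sigma> (All1 A) = All1 (subst_f (up \<sigma>) A)"
| "subst_f \<sigma> (All2 k n A) = All2 k n (subst_f \<sigma> A)"

text \<open>\<open>inst us\<close> replaces the innermost \<open>length us\<close> variables by \<open>us\<close> and lowers the other ones.\<close>

definition inst :: "'f trm list \<Rightarrow> nat \<Rightarrow> 'f trm" where
  "inst us i = (if i < length us then us ! i else TVar (i - length us))"

definition lift1 :: "nat \<Rightarrow> ('f, 'p) form \<Rightarrow> ('f, 'p) form" where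
  "lift1 c = subst_f (\<lambda>i. TVar (if i < c then i else Suc i))"

subsection \<open>Second-order substitution\<close>

primrec lift2 :: "kind \<Rightarrow> nat \<Rightarrow> nat \<Rightarrow> ('f, 'p) form \<Rightarrow> ('f, 'p) form" where
  "lift2 k n c Bot = Bot"
| "lift2 k n c (PVar k' i ts) =
     PVar k' (if (k', length ts) = (k, n) \<and> c \<le> i then Suc i else i) ts"
| "lift2 k n c (PSym p ts) = PSym p ts"
| "lift2 k n c (A \<rightarrow>\<^sub>t B) = (lift2 k n c A \<rightarrow>\<^sub>t lift2 k n c B)"
| "lift2 k n c (All1 A) = All1 (lift2 k n c A)"
| "lift2 k n c (All2 k' m A) =
     All2 k' m (lift2 k n (if (k', m) = (k, n) then Suc c else c) A)"

text \<open>\<open>subst2 k n c G A\<close> is \<open>A[G/X(x\<^sub>1,\<dots>,x\<^sub>n)]\<close>, with \<open>X\<close> the variable of sort \<open>(k, n)\<close> with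
  index \<open>c\<close>. In \<open>G\<close> the first-order indices \<open>0, \<dots>, n - 1\<close> stand for \<open>x\<^sub>1, \<dots>, x\<^sub>n\<close> and
  the indices from \<open>n\<close> on for the remaining free variables of \<open>G\<close>; hence the cut-off \<open>n\<close> in the
  clause for \<open>All1\<close>.\<close>

primrec subst2 ::
  "kind \<Rightarrow> nat \<Rightarrow> nat \<Rightarrow> ('f, 'p) form \<Rightarrow> ('f, 'p) form \<Rightarrow> ('f, 'p) form" where
  "subst2 k n c G Bot = Bot"
| "subst2 k n c G (PVar k' i ts) =
     (if (k', length ts) = (k, n)
      then (if i < c then PVar k' i ts
            else if i = c then subst_f (inst ts) G
            else PVar k' (i - 1) ts)
      else PVar k' i ts)"
| "subst2 k n c G (PSym p ts) = PSym p ts"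
| "subst2 k n c G (A \<rightarrow>\<^sub>t B) = (subst2 k n c G A \<rightarrow>\<^sub>t subst2 k n c G B)"
| "subst2 k n c G (All1 A) = All1 (subst2 k n c (lift1 n G) A)"
| "subst2 k n c G (All2 k' m A) =
     All2 k' m (subst2 k n (if (k', m) = (k, n) then Suc c else c) (lift2 k' m 0 G) A)"

section \<open>The type system M2\<close>

text \<open>A context is a list of types, the \<open>i\<close>-th one being that of \<open>Var i\<close>. In the introduction
  rules for the quantifiers, lifting the context expresses that the quantified variable is not free
  in it.\<close>

inductive M2 ::
  "('f, 'p) language \<Rightarrow> ('f trm \<times> 'f trm) set \<Rightarrow> ('f, 'p) form list \<Rightarrow> lam \<Rightarrow> ('f, 'p) form \<Rightarrow> bool"
  for L E where
  ax: "list_all (wf_form L) \<Gamma> \<Longrightarrow> i < length \<Gamma> \<Longrightarrow> M2 L E \<Gamma> (Var i) (\<Gamma> ! i)"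
| C: "list_all (wf_form L) \<Gamma> \<Longrightarrow>
    M2 L E \<Gamma> CConst (All2 Cls 0 (Neg (Neg (PVar Cls 0 [])) \<rightarrow>\<^sub>t PVar Cls 0 []))"
| imp_intro: "M2 L E (A # \<Gamma>) t B \<Longrightarrow> M2 L E \<Gamma> (Lam t) (A \<rightarrow>\<^sub>t B)"
| imp_elim: "M2 L E \<Gamma> t (A \<rightarrow>\<^sub>t B) \<Longrightarrow> M2 L E \<Gamma> u A \<Longrightarrow> M2 L E \<Gamma> (App t u) B"
| all1_intro: "M2 L E (map (lift1 0) \<Gamma>) t A \<Longrightarrow> M2 L E \<Gamma> t (All1 A)"
| all1_elim: "M2 L E \<Gamma> t (All1 A) \<Longrightarrow> wf_trm L u \<Longrightarrow> M2 L E \<Gamma> t (subst_f (inst [u]) A)"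
| all2_intro: "M2 L E (map (lift2 k n 0) \<Gamma>) t A \<Longrightarrow> M2 L E \<Gamma> t (All2 k n A)"
| all2_elim_ord: "M2 L E \<Gamma> t (All2 Ord n A) \<Longrightarrow> wf_form L G
    \<Longrightarrow> M2 L E \<Gamma> t (subst2 Ord n 0 G A)"
| all2_elim_cls: "M2 L E \<Gamma> t (All2 Cls n A) \<Longrightarrow> wf_form L G \<Longrightarrow> classical_type G
    \<Longrightarrow> M2 L E \<Gamma> t (subst2 Cls n 0 G A)"
| equational: "M2 L E \<Gamma> t (subst_f (inst [u]) A) \<Longrightarrow> eq_conseq L E u v
    \<Longrightarrow> M2 L E \<Gamma> t (subst_f (inst [v]) A)"

definition NatType :: "('f, 'p) language \<Rightarrow> 'f trm \<Rightarrow> ('f, 'p) form" where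
  "NatType L a =
     (let X = (\<lambda>u. PVar Ord 0 [u]) in
      All2 Ord 1
        (X (tzero L) \<rightarrow>\<^sub>t All1 (X (TVar 0) \<rightarrow>\<^sub>t X (tsucc L (TVar 0))) \<rightarrow>\<^sub>t X a))"

end

theory Submission
  imports Defs
begin

text \<open>Types are interpreted as sets of \<open>\<lambda>C\<close>-terms closed under \<open>\<beta>\<close>-expansion. Interpreting \<open>\<bottom>\<close>
  and all classical variables by the set of all terms makes every classical type, hence also the
  type of \<open>C\<close>, denote the set of all terms; so the rules for \<open>C\<close> and for the classical quantifier
  are sound for trivial reasons, and nothing is lost because \<open>N[x]\<close> only involves an ordinary
  variable. Interpreting that variable by the terms which reduce to \<open>(f)\<^sup>k x\<close>, at individuals
  \<open>a \<approx> s\<^sup>k(0)\<close>, shows that \<open>(t) x f\<close> reduces to \<open>(f)\<^sup>n x\<close>. Since \<open>(f)\<^sup>n x\<close> never ends with the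
  argument \<open>f\<close>, this forces \<open>t\<close> to reduce to an abstraction and \<open>(t) x\<close> as well, so that
  \<open>t \<simeq>\<^sub>\<beta> \<lambda>x \<lambda>f (t) x f\<close> without \<open>\<eta>\<close>. Working with expansion only makes confluence unnecessary.\<close>

section \<open>Substitution and reduction of \<open>\<lambda>C\<close>-terms\<close>

lemma lift_lift: "i \<le> k \<Longrightarrow> lift (Suc k) (lift i t) = lift i (lift k t)"
  by (induction t arbitrary: i k) auto

lemma lsubst_lift: "lsubst c u (lift c t) = t"
  by (induction t arbitrary: c u) auto

lemma lsubst_Suc_lift: "i \<le> c \<Longrightarrow> lsubst (Suc c) (lift i u) (lift i t) = lift i (lsubst c u t)"
  by (induction t arbitrary: i c u) (auto simp flip: lift_lift)

lemma lift_lsubst: "i \<le> c \<Longrightarrow> lift c (lsubst i u t) = lsubst i (lift c u) (lift (Suc c) t)"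
  by (induction t arbitrary: i c u) (auto simp: lift_lift)

lemma lsubst_Var_lift: "lsubst c (Var c) (lift (Suc c) t) = t"
  by (induction t arbitrary: c) auto

text \<open>Parallel substitution, since soundness speaks of all choices of realizers for a whole
  context; \<open>case_nat\<close> adds the variable of a binder in front.\<close>

primrec psubst :: "(nat \<Rightarrow> lam) \<Rightarrow> lam \<Rightarrow> lam" where
  "psubst \<theta> (Var i) = \<theta> i"
| "psubst \<theta> (App t u) = App (psubst \<theta> t) (psubst \<theta> u)"
| "psubst \<theta> (Lam t) = Lam (psubst (case_nat (Var 0) (\<lambda>i. lift 0 (\<theta> i))) t)"
| "psubst \<theta> CConst = CConst"

lemma psubst_Var: "psubst Var t = t"
proof -
  have "case_nat (Var 0) (\<lambda>i. Var (Suc i)) = Var"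
    by (auto simp: fun_eq_iff split: nat.split)
  then show ?thesis
    by (induction t) auto
qed

lemma lsubst_psubst: "lsubst c u (psubst \<theta> t) = psubst (\<lambda>i. lsubst c u (\<theta> i)) t"
proof (induction t arbitrary: c u \<theta>)
  case (Lam t)
  have "(\<lambda>i. lsubst (Suc c) (lift 0 u) (case_nat (Var 0) (\<lambda>i. lift 0 (\<theta> i)) i)) =
      case_nat (Var 0) (\<lambda>i. lift 0 (lsubst c u (\<theta> i)))"
    by (auto simp: fun_eq_iff lsubst_Suc_lift split: nat.split)
  then show ?case
    by (simp add: Lam)
qed auto

text \<open>Used for arrow introduction: contracting the redex made of an instantiated abstraction
  and \<open>u\<close> gives again a parallel instance, to which the induction hypothesis
  applies.\<close>

lemma lsubst_psubst_Lam:
  "lsubst 0 u (psubst (case_nat (Var 0) (\<lambda>i. lift 0 (\<theta> i))) t) = psubst (case_nat u \<theta>) t"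
proof -
  have "(\<lambda>i. lsubst 0 u (case_nat (Var 0) (\<lambda>i. lift 0 (\<theta> i)) i)) = case_nat u \<theta>"
    by (auto simp: fun_eq_iff lsubst_lift split: nat.split)
  then show ?thesis
    by (simp add: lsubst_psubst)
qed

section \<open>Compatibility of reduction with lifting and the term constructors\<close>

lemma beta_lift: "beta t u \<Longrightarrow> beta (lift c t) (lift c u)"
  by (induction arbitrary: c rule: beta.induct) (auto simp: lift_lsubst intro: beta.intros)

lemma betas_lift: "beta\<^sup>*\<^sup>* t u \<Longrightarrow> beta\<^sup>*\<^sup>* (lift c t) (lift c u)"
  by (induction rule: rtranclp_induct) (auto intro: beta_lift rtranclp.rtrancl_into_rtrancl)

lemma betas_AppL: "beta\<^sup>*\<^sup>* t t' \<Longrightarrow> beta\<^sup>*\<^sup>* (App t u) (App t' u)"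
  by (induction rule: rtranclp_induct) (auto intro: beta.intros rtranclp.rtrancl_into_rtrancl)

lemma betas_AppR: "beta\<^sup>*\<^sup>* u u' \<Longrightarrow> beta\<^sup>*\<^sup>* (App t u) (App t u')"
  by (induction rule: rtranclp_induct) (auto intro: beta.intros rtranclp.rtrancl_into_rtrancl)

lemma betas_Lam: "beta\<^sup>*\<^sup>* t t' \<Longrightarrow> beta\<^sup>*\<^sup>* (Lam t) (Lam t')"
  by (induction rule: rtranclp_induct) (auto intro: beta.intros rtranclp.rtrancl_into_rtrancl)

lemma betas_imp_beta_eq: "beta\<^sup>*\<^sup>* t u \<Longrightarrow> t \<simeq>\<^sub>\<beta> u"
  by (induction rule: rtranclp_induct) (auto intro: equivclp_into_equivclp)

lemma beta_eq_Lam: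
  assumes "t \<simeq>\<^sub>\<beta> u"
  shows "Lam t \<simeq>\<^sub>\<beta> Lam u"
  using assms
  by (induction rule: equivclp_induct) (auto intro: beta.intros equivclp_into_equivclp)

section \<open>Shapes of reducts and recovery of a Church numeral\<close>

lemma betas_Var: "beta\<^sup>*\<^sup>* (Var i) u \<Longrightarrow> u = Var i"
  by (induction rule: rtranclp_induct) (auto elim: beta.cases)

text \<open>Until the function part has become an abstraction no step can contract the outer
  application, so both sides reduce independently.\<close>

lemma betas_App_cases:
  assumes "beta\<^sup>*\<^sup>* (App t u) r"
  shows "(\<exists>w. beta\<^sup>*\<^sup>* t (Lam w)) \<or> (\<exists>t' u'. r = App t' u' \<and> beta\<^sup>*\<^sup>* t t' \<and> beta\<^sup>*\<^sup>* u u')"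
  using assms
proof (induction rule: rtranclp_induct)
  case (step r s)
  show ?case
  proof (cases "\<exists>w. beta\<^sup>*\<^sup>* t (Lam w)")
    case False
    then obtain t' u' where r: "r = App t' u'" "beta\<^sup>*\<^sup>* t t'" "beta\<^sup>*\<^sup>* u u'"
      using step.IH by blast
    from step.hyps(2) show ?thesis
      unfolding r(1) by cases (use r False in \<open>auto intro: rtranclp.rtrancl_into_rtrancl\<close>)
  qed simp
qed auto

text \<open>Once the head is an abstraction, the application to \<open>Var 0\<close> is a
  \<beta>-redex that renames the bound variable to itself.\<close>

lemma eta_of_abstraction:
  assumes "lift 0 t = t" "beta\<^sup>*\<^sup>* t (Lam w)"
  shows "Lam (App t (Var 0)) \<simeq>\<^sub>\<beta> t"
proof -
  have "beta\<^sup>*\<^sup>* (App t (Var 0)) (App (lift 0 (Lam w)) (Var 0))"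
    using betas_AppL betas_lift[OF assms(2), of 0] assms(1) by simp
  also have "beta (App (lift 0 (Lam w)) (Var 0)) (lsubst 0 (Var 0) (lift (Suc 0) w))"
    by (simp add: beta.intros(1))
  finally have "beta\<^sup>*\<^sup>* (App t (Var 0)) w"
    by (simp add: lsubst_Var_lift)
  then have "Lam (App t (Var 0)) \<simeq>\<^sub>\<beta> Lam w"
    by (intro betas_imp_beta_eq betas_Lam)
  then show ?thesis
    using betas_imp_beta_eq[OF assms(2)] by (meson equivclp_sym equivclp_trans)
qed

lemma closed_numeral_eq_church:
  assumes closed: "\<And>c. lift c t = t"
    and red: "\<And>i j. i \<noteq> j \<Longrightarrow>
      beta\<^sup>*\<^sup>* (App (App t (Var i)) (Var j)) ((App (Var j) ^^ n) (Var i))"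
  shows "t \<simeq>\<^sub>\<beta> church n"
proof -
  \<comment> \<open>The iterate is the variable \<open>Var 0\<close>, or its argument is
    \<open>Var 0\<close> or an application. As \<open>Var (Suc 0)\<close> reduces only to itself,
    the outer application must have been contracted.\<close>
  have "(App (Var (Suc 0)) ^^ n) (Var 0) \<noteq> App t' (Var (Suc 0))" for t'
    by (cases n; cases "n - 1") auto
  then obtain v where v: "beta\<^sup>*\<^sup>* (App t (Var 0)) (Lam v)"
    using betas_App_cases[OF red[of 0 "Suc 0"]] betas_Var by fastforce
  \<comment> \<open>\<open>Lam v\<close> is not an application, so \<open>t\<close> has to become an
    abstraction as well.\<close>
  then obtain w where w: "beta\<^sup>*\<^sup>* t (Lam w)"
    using betas_App_cases by blast
  \<comment> \<open>Under one more binder the base point is \<open>Var 1\<close>.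
    \<open>App t (Var 0)\<close> is not invariant under \<open>lift 0\<close>, so its expansion is
    contracted directly and not by \<open>eta_of_abstraction\<close>.\<close>
  have "beta\<^sup>*\<^sup>* (App t (Var 1)) (lift 0 (Lam v))"
    using betas_lift[OF v, of 0] by (simp add: closed)
  then have "beta\<^sup>*\<^sup>* (App (App t (Var 1)) (Var 0)) (App (lift 0 (Lam v)) (Var 0))"
    by (rule betas_AppL)
  also have "beta (App (lift 0 (Lam v)) (Var 0)) (lsubst 0 (Var 0) (lift (Suc 0) v))"
    by (simp add: beta.intros(1))
  finally have "beta\<^sup>*\<^sup>* (App (App t (Var 1)) (Var 0)) v"
    by (simp add: lsubst_Var_lift)
  then have "Lam (App (App t (Var 1)) (Var 0)) \<simeq>\<^sub>\<beta> Lam v"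
    by (intro betas_imp_beta_eq betas_Lam)
  then have "Lam (App (App t (Var 1)) (Var 0)) \<simeq>\<^sub>\<beta> App t (Var 0)"
    using betas_imp_beta_eq[OF v] by (meson equivclp_sym equivclp_trans)
  then have "Lam (Lam (App (App t (Var 1)) (Var 0))) \<simeq>\<^sub>\<beta> t"
    using beta_eq_Lam eta_of_abstraction[OF closed w] equivclp_trans by metis
  moreover have "Lam (Lam (App (App t (Var 1)) (Var 0))) \<simeq>\<^sub>\<beta> church n"
    unfolding church_def by (intro betas_imp_beta_eq betas_Lam red) simp
  ultimately show ?thesis
    by (meson equivclp_sym equivclp_trans)
qed

lemma M2_lift: "M2 L E \<Gamma> t A \<Longrightarrow> length \<Gamma> \<le> c \<Longrightarrow> lift c t = t"
  by (induction arbitrary: c rule: M2.induct) auto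

section \<open>Well-formedness and equational consequence\<close>

lemma subst_t_subst_t: "subst_t \<sigma> (subst_t \<tau> a) = subst_t (\<lambda>i. subst_t \<sigma> (\<tau> i)) a"
  by (induction a) auto

lemma wf_trm_subst_t: "\<forall>i. wf_trm L (\<sigma> i) \<Longrightarrow> wf_trm L (subst_t \<sigma> a) \<longleftrightarrow> wf_trm L a"
  by (induction a) (auto simp: list_all_iff)

lemma wf_trm_up: "\<forall>i. wf_trm L (\<sigma> i) \<Longrightarrow> \<forall>i. wf_trm L (up \<sigma> i)"
  by (auto simp: up_def wf_trm_subst_t split: nat.split)

lemma wf_form_subst_f: "\<forall>i. wf_trm L (\<sigma> i) \<Longrightarrow> wf_form L (subst_f \<sigma> A) \<longleftrightarrow> wf_form L A"
  by (induction A arbitrary: \<sigma>) (auto simp: list_all_iff wf_trm_subst_t wf_trm_up)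

lemma wf_form_lift1: "wf_form L (lift1 c A) \<longleftrightarrow> wf_form L A"
  unfolding lift1_def by (rule wf_form_subst_f) simp

lemma wf_form_lift2: "wf_form L (lift2 k n c A) \<longleftrightarrow> wf_form L A"
  by (induction A arbitrary: c) auto

lemma wf_trm_inst: "list_all (wf_trm L) us \<Longrightarrow> \<forall>i. wf_trm L (inst us i)"
  by (auto simp: inst_def list_all_length)

lemma wf_form_subst2: "wf_form L A \<Longrightarrow> wf_form L G \<Longrightarrow> wf_form L (subst2 k n c G A)"
  by (induction A arbitrary: c G)
    (auto simp: wf_form_subst_f wf_trm_inst wf_form_lift1 wf_form_lift2)

lemma eq_conseq_wf:
  assumes "wf_equations L E" "eq_conseq L E a b"
  shows "wf_trm L a \<and> wf_trm L b"
  using assms(2)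
proof (induction rule: eq_conseq.induct)
  case (eq_inst u v \<sigma>)
  then show ?case
    using assms(1) by (auto simp: wf_equations_def wf_trm_subst_t)
next
  case (eq_cong f as bs)
  then show ?case
    by (auto simp: list_all2_conv_all_nth list_all_length)
qed auto

text \<open>Supplies the well-formedness under which the interpretation is shown to respect
  \<approx>.\<close>

lemma M2_wf:
  assumes "wf_equations L E" "M2 L E \<Gamma> t A"
  shows "list_all (wf_form L) \<Gamma> \<and> wf_form L A"
  using assms(2)
proof (induction rule: M2.induct)
  case (equational \<Gamma> t u A v)
  then show ?case
    using eq_conseq_wf[OF assms(1)] by (auto simp: wf_form_subst_f wf_trm_inst)
qed (auto simp: list_all_length wf_form_lift1 wf_form_lift2 wf_form_subst_f wf_trm_inst
  wf_form_subst2)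

section \<open>Equational consequence under substitution, and numerals\<close>

lemma eq_conseq_subst_t:
  assumes "eq_conseq L E a b" "\<forall>i. wf_trm L (\<sigma> i)"
  shows "eq_conseq L E (subst_t \<sigma> a) (subst_t \<sigma> b)"
  using assms(1)
proof (induction rule: eq_conseq.induct)
  case (eq_inst u v \<tau>)
  then show ?case
    using assms(2) by (auto simp: subst_t_subst_t wf_trm_subst_t intro!: eq_conseq.eq_inst)
next
  case (eq_refl a)
  then show ?case
    using assms(2) by (auto simp: wf_trm_subst_t intro!: eq_conseq.eq_refl)
next
  case (eq_sym a b)
  then show ?case
    by (auto intro: eq_conseq.eq_sym)
next
  case (eq_trans a b c)
  then show ?case
    by (auto intro: eq_conseq.eq_trans)
next
  case (eq_cong f as bs)
  then show ?case
    by (auto simp: list_all2_conv_all_nth intro!: eq_conseq.eq_cong)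
qed

lemma eq_conseq_subst_t_cong:
  "wf_trm L a \<Longrightarrow> \<forall>i. eq_conseq L E (\<sigma> i) (\<tau> i) \<Longrightarrow> eq_conseq L E (subst_t \<sigma> a) (subst_t \<tau> a)"
proof (induction a)
  case (Fn f ts)
  then show ?case
    by (auto simp: list_all2_conv_all_nth list_all_length intro!: eq_conseq.eq_cong)
qed simp

lemma eq_conseq_tsucc:
  assumes "wf_language L" "eq_conseq L E a b"
  shows "eq_conseq L E (tsucc L a) (tsucc L b)"
  using assms by (auto simp: tsucc_def wf_language_def intro!: eq_conseq.eq_cong)

lemma wf_trm_numeral: "wf_language L \<Longrightarrow> wf_trm L ((tsucc L ^^ n) (tzero L))"
  by (induction n) (auto simp: wf_language_def tzero_def tsucc_def)

text \<open>Adequacy strips one successor from both sides; if one side is exhausted first, a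
  successor would be equal to zero.\<close>

lemma adequate_numeral_inj:
  assumes L: "wf_language L" and E: "adequate L E"
    and "eq_conseq L E ((tsucc L ^^ m) (tzero L)) ((tsucc L ^^ n) (tzero L))"
  shows "m = n"
  using assms(3)
proof (induction m arbitrary: n)
  case 0
  show ?case
  proof (cases n)
    case (Suc k)
    with 0 have "eq_conseq L E (tsucc L ((tsucc L ^^ k) (tzero L))) (tzero L)"
      by (auto intro: eq_conseq.eq_sym)
    then show ?thesis
      using E wf_trm_numeral[OF L] by (auto simp: adequate_def)
  qed simp
next
  case (Suc m)
  show ?case
  proof (cases n)
    case 0
    with Suc.prems show ?thesis
      using E wf_trm_numeral[OF L, of m] by (auto simp: adequate_def)
  next
    case (Suc k)
    with Suc.prems have "eq_conseq L E ((tsucc L ^^ m) (tzero L)) ((tsucc L ^^ k) (tzero L))"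
      using E wf_trm_numeral[OF L] by (auto simp: adequate_def)
    then show ?thesis
      using Suc Suc.IH by simp
  qed
qed

section \<open>The interpretation of types\<close>

definition expansion_closed :: "lam set \<Rightarrow> bool" where
  "expansion_closed S \<longleftrightarrow> (\<forall>t u. beta t u \<longrightarrow> u \<in> S \<longrightarrow> t \<in> S)"

definition admissible ::
  "('f, 'p) language \<Rightarrow> ('f trm \<times> 'f trm) set \<Rightarrow> ('f trm list \<Rightarrow> lam set) \<Rightarrow> bool" where
  "admissible L E P \<longleftrightarrow> (\<forall>ts. expansion_closed (P ts)) \<and>
     (\<forall>ts us. list_all2 (eq_conseq L E) ts us \<longrightarrow> P ts = P us)"

text \<open>The semantic counterpart of \<open>inst\<close>: singletons serve the first-order
  quantifier, longer lists the arguments of a substituted predicate.\<close>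

definition prepend :: "'a list \<Rightarrow> (nat \<Rightarrow> 'a) \<Rightarrow> nat \<Rightarrow> 'a" where
  "prepend ts \<sigma> i = (if i < length ts then ts ! i else \<sigma> (i - length ts))"

text \<open>A quantifier inserts at position 0; other positions arise when lifting or substitution
  passes under quantifiers of the same arity.\<close>

definition insert_pred :: "nat \<Rightarrow> nat \<Rightarrow> 'a \<Rightarrow> (nat \<Rightarrow> nat \<Rightarrow> 'a) \<Rightarrow> nat \<Rightarrow> nat \<Rightarrow> 'a" where
  "insert_pred n c P \<rho> =
     \<rho>(n := (\<lambda>i. if i < c then \<rho> n i else if i = c then P else \<rho> n (i - 1)))"

text \<open>\<open>\<rho> n i\<close> is the value of the ordinary variable of arity \<open>n\<close> with index \<open>i\<close>. Individuals are
  first-order terms; admissibility of the values of \<open>\<rho>\<close> replaces passing to the quotient by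
  \<open>\<approx>\<close>.\<close>

primrec interp :: "('f, 'p) language \<Rightarrow> ('f trm \<times> 'f trm) set \<Rightarrow> ('f, 'p) form \<Rightarrow>
    (nat \<Rightarrow> 'f trm) \<Rightarrow> (nat \<Rightarrow> nat \<Rightarrow> 'f trm list \<Rightarrow> lam set) \<Rightarrow> lam set" where
  "interp L E Bot \<sigma> \<rho> = UNIV"
| "interp L E (PVar k i ts) \<sigma> \<rho> =
     (case k of Ord \<Rightarrow> \<rho> (length ts) i (map (subst_t \<sigma>) ts) | Cls \<Rightarrow> UNIV)"
| "interp L E (PSym p ts) \<sigma> \<rho> = UNIV"
| "interp L E (A \<rightarrow>\<^sub>t B) \<sigma> \<rho> = {t. \<forall>u \<in> interp L E A \<sigma> \<rho>. App t u \<in> interp L E B \<sigma> \<rho>}"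
| "interp L E (All1 A) \<sigma> \<rho> = (\<Inter>a \<in> Collect (wf_trm L). interp L E A (prepend [a] \<sigma>) \<rho>)"
| "interp L E (All2 k n A) \<sigma> \<rho> =
     (case k of Ord \<Rightarrow> (\<Inter>P \<in> Collect (admissible L E). interp L E A \<sigma> (insert_pred n 0 P \<rho>))
              | Cls \<Rightarrow> interp L E A \<sigma> \<rho>)"

text \<open>The full set at the ending atom is preserved by arrows into it and by
  intersections.\<close>

lemma interp_classical: "classical_type A \<Longrightarrow> interp L E A \<sigma> \<rho> = UNIV"
  unfolding classical_type_def
  by (induction A arbitrary: \<sigma> \<rho>) (auto split: kind.split)

lemma admissible_insert_pred:
  "admissible L E P \<Longrightarrow> \<forall>m i. admissible L E (\<rho> m i) \<Longrightarrow>
    \<forall>m i. admissible L E (insert_pred n c P \<rho> m i)"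
  by (auto simp: insert_pred_def)

lemma wf_trm_prepend:
  "list_all (wf_trm L) ts \<Longrightarrow> \<forall>i. wf_trm L (\<sigma> i) \<Longrightarrow> \<forall>i. wf_trm L (prepend ts \<sigma> i)"
  by (auto simp: prepend_def list_all_length)

lemma eq_conseq_prepend:
  "list_all2 (eq_conseq L E) ts us \<Longrightarrow> \<forall>i. eq_conseq L E (\<sigma> i) (\<tau> i) \<Longrightarrow>
    \<forall>i. eq_conseq L E (prepend ts \<sigma> i) (prepend us \<tau> i)"
  by (auto simp: prepend_def list_all2_conv_all_nth)

text \<open>For an arrow, closure of the codomain suffices: expanding \<open>t\<close> expands
  \<open>App t u\<close>.\<close>

lemma expansion_closed_interp:
  "\<forall>m i. admissible L E (\<rho> m i) \<Longrightarrow> expansion_closed (interp L E A \<sigma> \<rho>)"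
proof (induction A arbitrary: \<sigma> \<rho>)
  case (PVar k i ts)
  then show ?case
    by (auto simp: admissible_def expansion_closed_def split: kind.split)
next
  case (Imp A B)
  then show ?case
    unfolding expansion_closed_def interp.simps mem_Collect_eq by (meson beta.intros(2))
next
  case (All1 A)
  then show ?case
    unfolding expansion_closed_def by fastforce
next
  case (All2 k n A)
  show ?case
  proof (cases k)
    case Ord
    have "expansion_closed (interp L E A \<sigma> (insert_pred n 0 P \<rho>))" if "admissible L E P" for P
      by (intro All2.IH admissible_insert_pred that All2.prems)
    then show ?thesis
      using Ord unfolding expansion_closed_def by simp
  qed (simp add: All2)
qed (auto simp: expansion_closed_def)

text \<open>The assignment enters only through arguments of atoms, where admissibility identifies
  the values.\<close>

lemma interp_eq_conseq:
  "wf_form L A \<Longrightarrow> \<forall>i. eq_conseq L E (\<sigma> i) (\<tau> i) \<Longrightarrow> \<forall>m i. admissible L E (\<rho> m i) \<Longrightarrow>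
    interp L E A \<sigma> \<rho> = interp L E A \<tau> \<rho>"
proof (induction A arbitrary: \<sigma> \<tau> \<rho>)
  case (PVar k i ts)
  have "list_all2 (eq_conseq L E) (map (subst_t \<sigma>) ts) (map (subst_t \<tau>) ts)"
    using PVar by (auto simp: list_all2_conv_all_nth list_all_length eq_conseq_subst_t_cong)
  then show ?case
    using PVar.prems(3) by (auto simp: admissible_def split: kind.split)
next
  case (Imp A B)
  then show ?case
    using Imp.IH(1)[of \<sigma> \<tau> \<rho>] Imp.IH(2)[of \<sigma> \<tau> \<rho>] by simp
next
  case (All1 A)
  have "interp L E A (prepend [a] \<sigma>) \<rho> = interp L E A (prepend [a] \<tau>) \<rho>" if "wf_trm L a" for a
    using All1.prems that
    by (intro All1.IH eq_conseq_prepend) (auto intro: eq_conseq.eq_refl)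
  then show ?case
    by simp
next
  case (All2 k n A)
  have "interp L E A \<sigma> (insert_pred n 0 P \<rho>) = interp L E A \<tau> (insert_pred n 0 P \<rho>)"
    if "admissible L E P" for P
    using All2.prems that by (intro All2.IH admissible_insert_pred) auto
  then show ?case
    using All2.prems All2.IH[of \<sigma> \<tau> \<rho>] by (auto split: kind.split)
qed auto

section \<open>Lifting and substitution under the interpretation\<close>

lemma subst_t_prepend_up:
  "subst_t (prepend [a] \<sigma>) (up \<tau> i) = prepend [a] (\<lambda>i. subst_t \<sigma> (\<tau> i)) i"
proof (cases i)
  case (Suc j)
  have "(\<lambda>i. subst_t (prepend [a] \<sigma>) (TVar (Suc i))) = \<sigma>"
    by (auto simp: prepend_def)
  then show ?thesis
    using Suc by (simp add: up_def subst_t_subst_t) (simp add: prepend_def)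
qed (simp add: up_def prepend_def)

lemma interp_subst_f:
  "interp L E (subst_f \<tau> A) \<sigma> \<rho> = interp L E A (\<lambda>i. subst_t \<sigma> (\<tau> i)) \<rho>"
proof (induction A arbitrary: \<sigma> \<tau> \<rho>)
  case (All1 A)
  then show ?case
    by (simp add: subst_t_prepend_up)
qed (auto simp: comp_def subst_t_subst_t split: kind.split)

lemma interp_inst:
  "interp L E (subst_f (inst us) A) \<sigma> \<rho> = interp L E A (prepend (map (subst_t \<sigma>) us) \<sigma>) \<rho>"
proof -
  have "(\<lambda>i. subst_t \<sigma> (inst us i)) = prepend (map (subst_t \<sigma>) us) \<sigma>"
    by (auto simp: inst_def prepend_def)
  then show ?thesis
    by (simp add: interp_subst_f)
qed

lemma interp_lift1:
  assumes "length ts = n"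
  shows "interp L E (lift1 n A) (prepend ts (prepend [a] \<sigma>)) \<rho> = interp L E A (prepend ts \<sigma>) \<rho>"
proof -
  have "(\<lambda>i. subst_t (prepend ts (prepend [a] \<sigma>)) (TVar (if i < n then i else Suc i))) = prepend ts \<sigma>"
    using assms by (auto simp: prepend_def)
  then show ?thesis
    by (simp add: lift1_def interp_subst_f)
qed

lemma insert_pred_commute:
  "insert_pred m 0 Q (insert_pred n c P \<rho>) =
    insert_pred n (if m = n then Suc c else c) P (insert_pred m 0 Q \<rho>)"
  by (auto simp: insert_pred_def fun_eq_iff)

lemma interp_lift2_Ord:
  "interp L E (lift2 Ord n c A) \<sigma> (insert_pred n c P \<rho>) = interp L E A \<sigma> \<rho>"
proof (induction A arbitrary: c \<sigma> \<rho>)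
  case (PVar k i ts)
  then show ?case
    by (auto simp: insert_pred_def split: kind.split)
next
  case (All2 k m A)
  then show ?case
    by (auto simp: insert_pred_commute split: kind.split)
qed auto

lemma interp_lift2_Cls: "interp L E (lift2 Cls n c A) \<sigma> \<rho> = interp L E A \<sigma> \<rho>"
  by (induction A arbitrary: c \<sigma> \<rho>) (auto split: kind.split)

text \<open>The lengths other than \<open>n\<close> never matter, but \<open>interp_lift1\<close> only identifies the values at lists
  of length \<open>n\<close>; hence the conditional.\<close>

definition pred_of :: "('f, 'p) language \<Rightarrow> ('f trm \<times> 'f trm) set \<Rightarrow> nat \<Rightarrow> ('f, 'p) form \<Rightarrow>
    (nat \<Rightarrow> 'f trm) \<Rightarrow> (nat \<Rightarrow> nat \<Rightarrow> 'f trm list \<Rightarrow> lam set) \<Rightarrow> 'f trm list \<Rightarrow> lam set" where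
  "pred_of L E n G \<sigma> \<rho> ts = (if length ts = n then interp L E G (prepend ts \<sigma>) \<rho> else UNIV)"

lemma pred_of_lift1: "pred_of L E n (lift1 n G) (prepend [a] \<sigma>) \<rho> = pred_of L E n G \<sigma> \<rho>"
  by (auto simp: pred_of_def fun_eq_iff interp_lift1)

lemma pred_of_lift2_Ord:
  "pred_of L E n (lift2 Ord m 0 G) \<sigma> (insert_pred m 0 P \<rho>) = pred_of L E n G \<sigma> \<rho>"
  by (auto simp: pred_of_def fun_eq_iff interp_lift2_Ord)

lemma pred_of_lift2_Cls: "pred_of L E n (lift2 Cls m 0 G) \<sigma> \<rho> = pred_of L E n G \<sigma> \<rho>"
  by (auto simp: pred_of_def fun_eq_iff interp_lift2_Cls)

lemma admissible_pred_of:
  assumes "wf_form L G" "\<forall>i. wf_trm L (\<sigma> i)" "\<forall>m i. admissible L E (\<rho> m i)"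
  shows "admissible L E (pred_of L E n G \<sigma> \<rho>)"
  unfolding admissible_def
proof (intro conjI allI impI)
  show "expansion_closed (pred_of L E n G \<sigma> \<rho> ts)" for ts
    using expansion_closed_interp[OF assms(3)]
    by (simp add: pred_of_def) (simp add: expansion_closed_def)
next
  fix ts us
  assume *: "list_all2 (eq_conseq L E) ts us"
  then have "interp L E G (prepend ts \<sigma>) \<rho> = interp L E G (prepend us \<sigma>) \<rho>"
    using assms by (intro interp_eq_conseq eq_conseq_prepend) (auto intro: eq_conseq.eq_refl)
  then show "pred_of L E n G \<sigma> \<rho> ts = pred_of L E n G \<sigma> \<rho> us"
    using * by (simp add: pred_of_def list_all2_lengthD)
qed

text \<open>Passing a quantifier lifts \<open>G\<close>, and \<open>pred_of\<close> is unchanged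
  under the correspondingly extended assignment. Together with \<open>admissible_pred_of\<close>
  this validates comprehension.\<close>

lemma interp_subst2_Ord:
  "interp L E (subst2 Ord n c G A) \<sigma> \<rho> =
    interp L E A \<sigma> (insert_pred n c (pred_of L E n G \<sigma> \<rho>) \<rho>)"
proof (induction A arbitrary: c G \<sigma> \<rho>)
  case (PVar k i ts)
  then show ?case
    by (auto simp: insert_pred_def pred_of_def interp_inst split: kind.split)
next
  case (All1 A)
  then show ?case
    by (simp add: pred_of_lift1)
next
  case (All2 k m A)
  then show ?case
    by (auto simp: insert_pred_commute pred_of_lift2_Ord pred_of_lift2_Cls split: kind.split)
qed auto

lemma classical_type_subst_f: "classical_type (subst_f \<sigma> A) \<longleftrightarrow> classical_type A"
  unfolding classical_type_def by (induction A arbitrary: \<sigma>) auto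

lemma classical_type_lift2: "classical_type (lift2 k n c A) \<longleftrightarrow> classical_type A"
  unfolding classical_type_def by (induction A arbitrary: c) auto

text \<open>Instances of \<open>G\<close> remain classical and so denote the full set, like the
  variable they replace.\<close>

lemma interp_subst2_Cls:
  "classical_type G \<Longrightarrow> interp L E (subst2 Cls n c G A) \<sigma> \<rho> = interp L E A \<sigma> \<rho>"
  by (induction A arbitrary: c G \<sigma> \<rho>)
    (auto simp: interp_classical classical_type_subst_f classical_type_lift2 lift1_def
      split: kind.split)

lemma interp_lift1_0: "interp L E (lift1 0 A) (prepend [a] \<sigma>) \<rho> = interp L E A \<sigma> \<rho>"
proof -
  have "prepend [] \<tau> = \<tau>" for \<tau> :: "nat \<Rightarrow> 'a trm"
    by (auto simp: prepend_def)
  then show ?thesis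
    using interp_lift1[of "[]" 0 L E A a \<sigma> \<rho>] by simp
qed

text \<open>The induction keeps assignments and realizers arbitrary: quantifier introductions extend
  the former, arrow introduction the latter.\<close>

theorem M2_sound:
  assumes E: "wf_equations L E"
    and "M2 L E \<Gamma> t A"
    and "\<forall>i. wf_trm L (\<sigma> i)" "\<forall>m i. admissible L E (\<rho> m i)"
    and "\<forall>i < length \<Gamma>. \<theta> i \<in> interp L E (\<Gamma> ! i) \<sigma> \<rho>"
  shows "psubst \<theta> t \<in> interp L E A \<sigma> \<rho>"
  using assms(2-)
proof (induction arbitrary: \<sigma> \<rho> \<theta> rule: M2.induct)
  case (imp_intro A \<Gamma> t B)
  show ?case
  proof (simp, intro ballI)
    fix u
    assume u: "u \<in> interp L E A \<sigma> \<rho>"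
    have "psubst (case_nat u \<theta>) t \<in> interp L E B \<sigma> \<rho>"
      using imp_intro.prems u
      by (intro imp_intro.IH) (auto simp: nth_Cons split: nat.split)
    \<comment> \<open>This is the contractum of the application to \<open>u\<close>; closure under
      expansion leads back to the redex.\<close>
    then have "lsubst 0 u (psubst (case_nat (Var 0) (\<lambda>i. lift 0 (\<theta> i))) t) \<in> interp L E B \<sigma> \<rho>"
      by (simp add: lsubst_psubst_Lam)
    then show "App (Lam (psubst (case_nat (Var 0) (\<lambda>i. lift 0 (\<theta> i))) t)) u \<in> interp L E B \<sigma> \<rho>"
      using expansion_closed_interp[OF imp_intro.prems(2)] beta.intros(1)
      unfolding expansion_closed_def by blast
  qed
next
  case (all1_intro \<Gamma> t A)
  have "psubst \<theta> t \<in> interp L E A (prepend [a] \<sigma>) \<rho>" if "wf_trm L a" for a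
    using all1_intro.prems that
    by (intro all1_intro.IH wf_trm_prepend) (auto simp: interp_lift1_0)
  then show ?case
    by simp
next
  case (all1_elim \<Gamma> t A u)
  then have "psubst \<theta> t \<in> interp L E A (prepend [subst_t \<sigma> u] \<sigma>) \<rho>"
    by (auto simp: wf_trm_subst_t)
  then show ?case
    by (simp add: interp_inst)
next
  case (all2_intro k n \<Gamma> t A)
  show ?case
  proof (cases k)
    case Ord
    have "psubst \<theta> t \<in> interp L E A \<sigma> (insert_pred n 0 P \<rho>)" if "admissible L E P" for P
      using all2_intro.prems that Ord
      by (intro all2_intro.IH admissible_insert_pred) (auto simp: interp_lift2_Ord)
    then show ?thesis
      using Ord by simp
  next
    case Cls
    then show ?thesis
      using all2_intro by (simp add: interp_lift2_Cls)
  qed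
next
  case (all2_elim_ord \<Gamma> t n A G)
  have "admissible L E (pred_of L E n G \<sigma> \<rho>)"
    using all2_elim_ord by (intro admissible_pred_of)
  then show ?case
    using all2_elim_ord.IH[OF all2_elim_ord.prems] by (simp add: interp_subst2_Ord)
next
  case (all2_elim_cls \<Gamma> t n A G)
  then show ?case
    by (simp add: interp_subst2_Cls)
next
  case (equational \<Gamma> t u A v)
  \<comment> \<open>Well-formedness of an instance passes back to \<open>A\<close>, as
    \<open>interp_eq_conseq\<close> requires.\<close>
  have "wf_trm L u" "wf_form L (subst_f (inst [u]) A)"
    using eq_conseq_wf[OF E equational.hyps(2)] M2_wf[OF E equational.hyps(1)] by auto
  then have "wf_form L A"
    by (simp add: wf_form_subst_f wf_trm_inst)
  then have "interp L E A (prepend [subst_t \<sigma> u] \<sigma>) \<rho> = interp L E A (prepend [subst_t \<sigma> v] \<sigma>) \<rho>"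
    using equational.prems equational.hyps(2)
    by (intro interp_eq_conseq eq_conseq_prepend) (auto intro: eq_conseq.eq_refl eq_conseq_subst_t)
  then show ?case
    using equational.IH[OF equational.prems] by (simp add: interp_inst)
qed auto

section \<open>Typed integers\<close>

text \<open>Comparing whole argument lists makes the value empty at lengths other than one and
  invariant under \<approx>.\<close>

definition numeral_pred ::
  "('f, 'p) language \<Rightarrow> ('f trm \<times> 'f trm) set \<Rightarrow> lam \<Rightarrow> lam \<Rightarrow> 'f trm list \<Rightarrow> lam set" where
  "numeral_pred L E x f ts =
     {u. \<exists>k. list_all2 (eq_conseq L E) ts [(tsucc L ^^ k) (tzero L)] \<and> beta\<^sup>*\<^sup>* u ((App f ^^ k) x)}"

lemma admissible_numeral_pred: "admissible L E (numeral_pred L E x f)"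
  unfolding admissible_def
proof (intro conjI allI impI)
  show "expansion_closed (numeral_pred L E x f ts)" for ts
    by (auto simp: expansion_closed_def numeral_pred_def intro: converse_rtranclp_into_rtranclp)
next
  fix ts us
  assume "list_all2 (eq_conseq L E) ts us"
  then have "list_all2 (eq_conseq L E) ts vs \<longleftrightarrow> list_all2 (eq_conseq L E) us vs" for vs
    by (auto simp: list_all2_conv_all_nth) (meson eq_conseq.eq_sym eq_conseq.eq_trans)+
  then show "numeral_pred L E x f ts = numeral_pred L E x f us"
    by (simp add: numeral_pred_def)
qed

lemma subst_t_tzero: "subst_t \<sigma> (tzero L) = tzero L"
  by (simp add: tzero_def)

lemma subst_t_tsucc: "subst_t \<sigma> (tsucc L a) = tsucc L (subst_t \<sigma> a)"
  by (simp add: tsucc_def)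

lemma subst_t_numeral: "subst_t \<sigma> ((tsucc L ^^ n) (tzero L)) = (tsucc L ^^ n) (tzero L)"
  by (induction n) (auto simp: subst_t_tzero subst_t_tsucc)

lemma M2_numeral_reduces:
  assumes L: "wf_language L" and E: "wf_equations L E" "adequate L E"
    and t: "M2 L E [] t (NatType L ((tsucc L ^^ n) (tzero L)))"
  shows "beta\<^sup>*\<^sup>* (App (App t x) f) ((App f ^^ n) x)"
proof -
  let ?P = "numeral_pred L E x f"
  let ?N = "\<lambda>k. (tsucc L ^^ k) (tzero L)"
  have P: "u \<in> ?P [a] \<longleftrightarrow> (\<exists>k. eq_conseq L E a (?N k) \<and> beta\<^sup>*\<^sup>* u ((App f ^^ k) x))" for u a
    by (auto simp: numeral_pred_def)
  \<comment> \<open>The type is closed, so any well-formed assignment with admissible predicates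
    will do; the full set is one.\<close>
  have "psubst Var t \<in> interp L E (NatType L (?N n)) TVar (\<lambda>_ _ _. UNIV)"
    using t by (intro M2_sound[OF E(1)]) (auto simp: admissible_def expansion_closed_def)
  then have *: "App (App t x') f' \<in> ?P [?N n]"
    if "x' \<in> ?P [tzero L]"
      and "\<And>a u. wf_trm L a \<Longrightarrow> u \<in> ?P [a] \<Longrightarrow> App f' u \<in> ?P [tsucc L a]" for x' f'
    using that admissible_numeral_pred[of L E x f]
    by (simp add: NatType_def psubst_Var insert_pred_def prepend_def
        subst_t_numeral subst_t_tzero subst_t_tsucc)
  have "x \<in> ?P [tzero L]"
    using wf_trm_numeral[OF L, of 0] by (auto simp: P intro!: exI[of _ 0] eq_conseq.eq_refl)
  moreover have "App f u \<in> ?P [tsucc L a]" if "u \<in> ?P [a]" for a u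
  proof -
    from that obtain k where "eq_conseq L E a (?N k)" "beta\<^sup>*\<^sup>* u ((App f ^^ k) x)"
      by (auto simp: P)
    then show ?thesis
      by (auto simp: P intro!: exI[of _ "Suc k"] eq_conseq_tsucc[OF L] betas_AppR)
  qed
  ultimately have "App (App t x) f \<in> ?P [?N n]"
    by (intro *)
  \<comment> \<open>Membership only gives some exponent \<open>k\<close>; adequacy identifies it
    with \<open>n\<close>.\<close>
  then show ?thesis
    using adequate_numeral_inj[OF L E(2)] by (auto simp: P)
qed

theorem theorem5p5:
  fixes L :: "('f, 'p) language"
    and E :: "('f trm \<times> 'f trm) set"
    and n :: nat
    and t :: lam
  assumes "wf_language L"
    and "wf_equations L E"
    and "adequate L E"
    and "M2 L E [] t (NatType L ((tsucc L ^^ n) (tzero L)))"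
  shows "t \<simeq>\<^sub>\<beta> church n"
proof (rule closed_numeral_eq_church)
  show "lift c t = t" for c
    using M2_lift[OF assms(4)] by simp
  show "beta\<^sup>*\<^sup>* (App (App t (Var i)) (Var j)) ((App (Var j) ^^ n) (Var i))" for i j
    using assms by (rule M2_numeral_reduces)
qed

end
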